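(* Let $n$ be a positive integer and $b>1$ an integer. There exists an integer $c$ with $0\le c\le b-1$ such that $2^n=(1,c,1)_b$ (i.e. $2^n=1+cb+b^2$) and this representation is not of binomial form (i.e. it is not the case that $c=2$) if and only if both of the following hold: (1) there is a factorization $2^n-1=kb$ with $k$ an integer satisfying $b\le k\le 2b-1$; and (2) it is not the case that $n$ is even and $b=2^{n/2}-1$.
   Context: For an integer $b>1$, $(c_m,\ldots,c_0)_b$ denotes $\sum_{i=0}^m c_i b^i$ with integer digits $0\le c_i<b$, $c_m>0$. A representation has binomial form if its digits are $\alpha\binom{m}{m},\ldots,\alpha\binom{m}{0}$ for a positive integer $\alpha$; a 3-digit representation $(1,c,1)_b$ has binomial form exactly when it equals $(1,2,1)_b$. *)

theory Defs
  imports Complex_Main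
begin

text \<open>
  Digit lists are written with the most significant digit first, so that \<open>[c\<^sub>m, \<dots>, c\<^sub>0]\<close>
  stands for \<open>(c\<^sub>m, \<dots>, c\<^sub>0)\<^sub>b\<close>; the reversal makes index \<open>i\<close> refer to \<open>c\<^sub>i\<close>.
\<close>

definition digits_value :: "int \<Rightarrow> int list \<Rightarrow> int" where
  "digits_value b cs = (\<Sum>i<length cs. rev cs ! i * b ^ i)"

definition base_rep :: "int \<Rightarrow> int list \<Rightarrow> int \<Rightarrow> bool" where
  "base_rep b cs N \<longleftrightarrow>
     b > 1 \<and> cs \<noteq> [] \<and> hd cs > 0 \<and> (\<forall>c\<in>set cs. 0 \<le> c \<and> c < b) \<and> N = digits_value b cs"

definition binomial_form :: "int list \<Rightarrow> bool" where
  "binomial_form cs \<longleftrightarrow>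
     (\<exists>(\<alpha>::int) (m::nat). \<alpha> > 0 \<and> cs = map (\<lambda>i. \<alpha> * int (m choose i)) (rev [0..<Suc m]))"

lemma digits_value_three: "digits_value b [1, c, 1] = 1 + c * b + b\<^sup>2"
  by (simp add: digits_value_def power2_eq_square)

lemma base_rep_three:
  "base_rep b [1, c, 1] N \<longleftrightarrow> b > 1 \<and> 0 \<le> c \<and> c \<le> b - 1 \<and> N = 1 + c * b + b\<^sup>2"
  by (auto simp: base_rep_def digits_value_three)

lemma binomial_form_three: "binomial_form [1, c, 1] \<longleftrightarrow> c = 2"
proof
  assume "binomial_form [1, c, 1]"
  then obtain \<alpha> :: int and m :: nat
    where eq: "[1, c, 1] = map (\<lambda>i. \<alpha> * int (m choose i)) (rev [0..<Suc m])"
    unfolding binomial_form_def by (elim exE conjE)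
  from arg_cong[OF eq, of length] have "m = 2" by simp
  with eq show "c = 2" by (simp add: upt_rec numeral_2_eq_2)
next
  assume "c = 2"
  then have "[1, c, 1] = map (\<lambda>i. 1 * int (2 choose i)) (rev [0..<Suc 2])"
    by (simp add: upt_rec numeral_2_eq_2)
  then show "binomial_form [1, c, 1]"
    unfolding binomial_form_def by (intro exI conjI) (rule zero_less_one)
qed

end

theory Submission
  imports Defs "HOL-Computational_Algebra.Primes"
begin

text \<open>
  Put \<open>k = b + c\<close>: then \<open>1 + c b + b\<^sup>2 = 2\<^sup>n\<close> says \<open>2\<^sup>n - 1 = k b\<close>, and the bounds on \<open>c\<close> are
  the bounds on \<open>k\<close>. The excluded value \<open>c = 2\<close> is the case \<open>(b + 1)\<^sup>2 = 2\<^sup>n\<close>, in which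
  \<open>b + 1\<close> must itself be a power of 2.
\<close>

text \<open>\<open>x\<close> divides its own square, and every divisor of a power of the prime 2 is
  itself a power of 2, say \<open>x = 2 ^ i\<close>; comparing exponents gives
  \<open>n = i * 2\<close>.\<close>

lemma square_eq_power_of_two_iff:
  fixes x :: int
  assumes "x > 0"
  shows "x\<^sup>2 = 2 ^ n \<longleftrightarrow> even n \<and> x = 2 ^ (n div 2)"
proof
  assume sq: "x\<^sup>2 = 2 ^ n"
  \<comment> \<open>The divisor argument runs in \<open>nat\<close>; positivity of \<open>x\<close>
    makes the passage lossless.\<close>
  have "int ((nat x)\<^sup>2) = int (2 ^ n)"
    using assms sq by simp
  then have nat_sq: "(nat x)\<^sup>2 = 2 ^ n"
    by (simp only: of_nat_eq_iff)
  then have "nat x dvd 2 ^ n"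
    by (metis dvd_triv_left power2_eq_square)
  then obtain i where i: "nat x = 2 ^ i"
    using divides_primepow_nat[OF two_is_prime_nat] by blast
  with nat_sq have "(2::nat) ^ (i * 2) = 2 ^ n"
    by (simp add: power_mult)
  then have "n = i * 2"
    by simp
  moreover have "x = 2 ^ i"
    using i assms by (metis int_nat_eq less_imp_le of_nat_numeral of_nat_power)
  ultimately show "even n \<and> x = 2 ^ (n div 2)"
    by simp
next
  assume "even n \<and> x = 2 ^ (n div 2)"
  then show "x\<^sup>2 = 2 ^ n"
    by (simp flip: power_mult)
qed

theorem theorem2p3:
  fixes n :: nat and b :: int
  assumes "n > 0" and "b > 1"
  shows "(\<exists>c::int. 0 \<le> c \<and> c \<le> b - 1 \<and> base_rep b [1, c, 1] (2 ^ n) \<and> \<not> binomial_form [1, c, 1])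
    \<longleftrightarrow> (\<exists>k::int. 2 ^ n - 1 = k * b \<and> b \<le> k \<and> k \<le> 2 * b - 1)
        \<and> \<not> (even n \<and> b = 2 ^ (n div 2) - 1)"
proof -
  \<comment> \<open>Written as a square, the exception can be compared directly with the expansion
    of \<open>2 ^ n\<close>.\<close>
  have excluded: "even n \<and> b = 2 ^ (n div 2) - 1 \<longleftrightarrow> (b + 1)\<^sup>2 = 2 ^ n"
    using square_eq_power_of_two_iff[of "b + 1" n] \<open>b > 1\<close> by auto
  have two: "(b + 1)\<^sup>2 = 2 ^ n \<longleftrightarrow> c = 2" if "2 ^ n = 1 + c * b + b\<^sup>2" for c
  proof -
    \<comment> \<open>The terms 1 and \<open>b\<^sup>2\<close> cancel, leaving only the middle
      terms; then \<open>b\<close> is cancelled as nonzero.\<close>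
    have "(b + 1)\<^sup>2 = 2 ^ n \<longleftrightarrow> 2 * b = c * b"
      unfolding that by (auto simp: power2_eq_square algebra_simps)
    then show ?thesis
      using \<open>b > 1\<close> by auto
  qed
  show ?thesis
    unfolding base_rep_three binomial_form_three excluded
  proof safe
    fix c assume c: "0 \<le> c" "c \<le> b - 1" "2 ^ n = 1 + c * b + b\<^sup>2" and "c \<noteq> 2"
    then show "\<exists>k. 2 ^ n - 1 = k * b \<and> b \<le> k \<and> k \<le> 2 * b - 1"
      by (intro exI[of _ "b + c"]) (simp add: power2_eq_square algebra_simps)
    show False if "(b + 1)\<^sup>2 = 2 ^ n"
      using two[OF c(3)] that \<open>c \<noteq> 2\<close> by blast
  next
    fix k assume k: "2 ^ n - 1 = k * b" "b \<le> k" "k \<le> 2 * b - 1" and "(b + 1)\<^sup>2 \<noteq> 2 ^ n"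
    have rep: "2 ^ n = 1 + (k - b) * b + b\<^sup>2"
      using k(1) by (simp add: power2_eq_square algebra_simps)
    with two[OF this] k \<open>(b + 1)\<^sup>2 \<noteq> 2 ^ n\<close> \<open>b > 1\<close>
    show "\<exists>c. 0 \<le> c \<and> c \<le> b - 1 \<and> (1 < b \<and> 0 \<le> c \<and> c \<le> b - 1 \<and> 2 ^ n = 1 + c * b + b\<^sup>2) \<and> c \<noteq> 2"
      by (intro exI[of _ "k - b"]) auto
  qed
qed

end
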